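(* Let $N$ be a finite set with $|N|\geq 2$. The polyhedron of vectors $u\in\mathbb{R}^{\mathcal{P}(N)}$ given by the constraints (a) $\sum_{T\subseteq N}u(T)=0$ and $\sum_{T\subseteq N,\,j\in T}u(T)=0$ for every $j\in N$; (b) $\sum_{T\in\mathcal{A}}u(T)\leq 1$ for every non-empty class $\mathcal{A}$ of non-empty subsets of $N$ which is closed under supersets; (c) $\sum_{T\subseteq N,\,|C\cap T|\geq 2}u(T)\cdot(|C\cap T|-1)\geq 0$ for every $C\subseteq N$ with $|C|\geq 2$; is an LP relaxation of the standard imset polytope over $N$.
   Context: $\mathcal{P}(N)$ is the power set of $N$. A class $\mathcal{A}$ of subsets of $N$ is closed under supersets if $S\in\mathcal{A}$, $S\subseteq T\subseteq N$ implies $T\in\mathcal{A}$. A directed graph over $N$ has node set $N$ and a collection of arrows $j\to i$ with $i,j\in N$, $i\neq j$; $\mathrm{pa}_G(i)=\{j\in N;\ j\to i\text{ in }G\}$. It is acyclic if it has no directed cycle (sequence $i_1,\ldots,i_n$, $n\geq 3$, with $i_r\to i_{r+1}$ for $r=1,\ldots,n-1$ and $i_n=i_1$). For $A\subseteq N$, $\delta_A\in\mathbb{R}^{\mathcal{P}(N)}$ is the vector with $\delta_A(A)=1$ and $\delta_A(S)=0$ for $S\neq A$. For an acyclic directed graph $G$ over $N$ the standard imset is $$u_G=\delta_N-\delta_{\emptyset}+\sum_{i\in N}\left[\delta_{\mathrm{pa}_G(i)}-\delta_{\{i\}\cup\mathrm{pa}_G(i)}\right].$$ The standard imset polytope is the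 convex hull in $\mathbb{R}^{\mathcal{P}(N)}$ of the set of all $u_G$, where $G$ runs over all acyclic directed graphs over $N$. An LP relaxation of a polytope is an outer polyhedral approximation of it (a polyhedron containing the polytope) such that the only lattice points (vectors with integer components) in the polyhedron are the lattice points in the polytope. *)

theory Defs
  imports "HOL-Analysis.Analysis"
begin

text \<open>
  The finite set \<open>N\<close> of variables is the universe of a finite type \<open>'n\<close>, so that
  the vector space indexed by the power set of \<open>N\<close> is \<open>real ^ 'n set\<close>.
  A directed graph over \<open>N\<close> is its set of arrows: \<open>(j, i) \<in> G\<close> stands for
  an arrow from \<open>j\<close> to \<open>i\<close>.
\<close>

definition digraph :: "('n \<times> 'n) set \<Rightarrow> bool" where
  "digraph G \<longleftrightarrow> irrefl G"

definition acyclic_digraph :: "('n \<times> 'n) set \<Rightarrow> bool" where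
  "acyclic_digraph G \<longleftrightarrow> digraph G \<and> acyclic G"

definition parents :: "('n \<times> 'n) set \<Rightarrow> 'n \<Rightarrow> 'n set" where
  "parents G i = {j. (j, i) \<in> G}"

definition delta :: "'n::finite set \<Rightarrow> real ^ 'n set" where
  "delta A = (\<chi> S. if S = A then 1 else 0)"

definition standard_imset :: "('n::finite \<times> 'n) set \<Rightarrow> real ^ 'n set" where
  "standard_imset G = delta UNIV - delta {}
     + (\<Sum>i\<in>UNIV. delta (parents G i) - delta ({i} \<union> parents G i))"

definition standard_imset_polytope :: "(real ^ 'n::finite set) set" where
  "standard_imset_polytope = convex hull {standard_imset G | G. acyclic_digraph G}"

definition closed_under_supersets :: "'n set set \<Rightarrow> bool" where
  "closed_under_supersets \<A> \<longleftrightarrow> (\<forall>S T. S \<in> \<A> \<longrightarrow> S \<subseteq> T \<longrightarrow> T \<in> \<A>)"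

definition lattice_points :: "(real ^ 'k) set" where
  "lattice_points = {x. \<forall>i. x $ i \<in> \<int>}"

definition lp_relaxation :: "(real ^ 'k) set \<Rightarrow> (real ^ 'k) set \<Rightarrow> bool" where
  "lp_relaxation Q P \<longleftrightarrow> polytope P \<and> polyhedron Q \<and> P \<subseteq> Q
     \<and> Q \<inter> lattice_points = P \<inter> lattice_points"

end

theory Submission
  imports Defs
begin

text \<open>
  Every constraint tests \<open>u\<close> against a weight \<open>w\<close> on the subsets of \<open>N\<close>, through
  \<open>\<Sum>T. u(T) w(T)\<close>. On a standard imset this number is \<open>w(N) - w(\<emptyset>)\<close> minus the increments
  \<open>w({i} \<union> pa(i)) - w(pa(i))\<close>, one for each node \<open>i\<close>. For an arbitrary loopless digraph this
  formula gives (a) and (b), as no node is its own parent and as \<open>w\<close> is monotone in (b). For the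
  weight \<open>T \<mapsto> max(|C \<inter> T| - 1, 0)\<close> of (c), the increment of \<open>i\<close> is \<open>1\<close> if \<open>i\<close> lies
  in \<open>C\<close> and has a parent in \<open>C\<close>, and \<open>0\<close> otherwise, so that (c) for \<open>C\<close>
  says that some node of \<open>C\<close> has no parent in \<open>C\<close>. For all \<open>C\<close>
  together this is well-foundedness of the arrow relation, which for a finite digraph is acyclicity
  (lemma \<open>acyclic_iff_cluster_inequalities\<close>).

  It remains to see that an integer vector \<open>u\<close> that satisfies (a) and (b) is the imset of a loopless
  digraph. Read \<open>d = u - \<delta>\<^sub>N + \<delta>\<^sub>\<emptyset>\<close> as prescribed values of inflow minus outflow on the Boolean
  lattice, where a flow may use the edges from \<open>{i} \<union> B\<close> down to \<open>B\<close>, without a bound on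
  capacities. No edge enters a superset-closed class from outside, so a flow can only exist if \<open>d\<close>
  has a nonpositive sum over each such class. This is (b), and for the class of all subsets, whose
  sum is zero, the first equation in (a). As in the theorems of Gale and
  Hoffman, the condition is also sufficient, and integer data admit an integer flow (lemma
  \<open>integer_flow_on_Boolean_lattice\<close>). The equation for \<open>j\<close> in (a) says that the edges which remove
  \<open>j\<close> carry one unit in total. Since the flow is integral, this unit travels along a single edge,
  from \<open>{j} \<union> B\<close> to \<open>B\<close>, and \<open>B\<close> is taken as the parent set of \<open>j\<close>.
\<close>

section \<open>Integer flows on the Boolean lattice\<close>

text \<open>
  Call a superset-closed class tight if its \<open>d\<close>-sum is zero. Sums over sets are modular, so the
  intersection of two tight classes is tight and there is a least tight class \<open>M\<close> containing \<open>S\<close>.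
  If \<open>S\<close> were minimal in \<open>M\<close>, then \<open>M - {S}\<close> would be superset-closed with sum \<open>- d(S) > 0\<close>.
  Hence one of the units that must leave \<open>S\<close> can be sent down an edge that leaves no tight class.
\<close>

lemma edge_within_tight_classes:
  fixes d :: "'n::finite set \<Rightarrow> int"
  assumes upper: "\<And>\<A>. closed_under_supersets \<A> \<Longrightarrow> sum d \<A> \<le> 0"
    and total: "sum d UNIV = 0"
    and neg: "d S < 0"
  obtains i where "i \<in> S"
    "\<And>\<A>. closed_under_supersets \<A> \<Longrightarrow> sum d \<A> = 0 \<Longrightarrow> S \<in> \<A> \<Longrightarrow> S - {i} \<in> \<A>"
proof -
  define tight where
    "tight \<A> \<longleftrightarrow> closed_under_supersets \<A> \<and> sum d \<A> = 0 \<and> S \<in> \<A>" for \<A>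
  have "tight UNIV"
    using total by (simp add: tight_def closed_under_supersets_def)
  then obtain M where M: "tight M" and least_card: "\<And>\<A>. tight \<A> \<Longrightarrow> card M \<le> card \<A>"
    using ex_has_least_nat[of tight UNIV card] by blast
  have M_least: "M \<subseteq> \<A>" if "tight \<A>" for \<A>
  proof -
    have up: "closed_under_supersets (\<A> \<union> M)" "closed_under_supersets (\<A> \<inter> M)"
      using that M unfolding tight_def closed_under_supersets_def by blast+
    have "sum d (\<A> \<union> M) + sum d (\<A> \<inter> M) = sum d \<A> + sum d M"
      by (rule sum.union_inter) auto
    then have "sum d (\<A> \<inter> M) = 0"
      using upper[OF up(1)] upper[OF up(2)] that M by (simp add: tight_def)
    then have "tight (\<A> \<inter> M)"
      using that M up(2) by (simp add: tight_def)
    then have "\<A> \<inter> M = M"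
      by (intro card_seteq least_card) auto
    then show ?thesis
      by blast
  qed
  have "\<exists>R\<in>M. R \<subset> S"
  proof (rule ccontr)
    assume "\<not> ?thesis"
    then have "closed_under_supersets (M - {S})"
      using M unfolding tight_def closed_under_supersets_def by blast
    then have "sum d (M - {S}) \<le> 0"
      by (rule upper)
    moreover have "sum d M = d S + sum d (M - {S})"
      using M by (intro sum.remove) (auto simp: tight_def)
    ultimately show False
      using neg M by (simp add: tight_def)
  qed
  then obtain R i where "R \<in> M" "i \<in> S" "R \<subseteq> S - {i}"
    by blast
  then have "S - {i} \<in> M"
    using M unfolding tight_def closed_under_supersets_def by blast
  with \<open>i \<in> S\<close> show ?thesis
    using that M_least unfolding tight_def by blast
qed

text \<open>
  The flow is built one unit at a time. Splitting off a unit whose edge leaves no tight class keeps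
  all sums over superset-closed classes nonpositive, because the only sums that grow are those over
  the classes that the edge leaves, and they grow by one from a negative integer. The process ends
  because each unit raises \<open>\<Sum>S. d(S) |S|\<close> by one, and this number is bounded by zero: it
  is the sum over \<open>j\<close> of the sums of \<open>d\<close> over the superset-closed classes \<open>{S. j \<in> S}\<close>.
  The divergence of the flow is described by its effect on test weights \<open>w\<close>.
\<close>

lemma integer_flow_on_Boolean_lattice:
  fixes d :: "'n::finite set \<Rightarrow> int"
  assumes "\<And>\<A>. closed_under_supersets \<A> \<Longrightarrow> sum d \<A> \<le> 0"
    and "sum d UNIV = 0"
  shows "\<exists>\<eta> :: 'n \<Rightarrow> 'n set \<Rightarrow> nat. (\<forall>i B. i \<in> B \<longrightarrow> \<eta> i B = 0) \<and>
    (\<forall>w. (\<Sum>S\<in>UNIV. d S * w S) = (\<Sum>i\<in>UNIV. \<Sum>B\<in>UNIV. int (\<eta> i B) * (w B - w (insert i B))))"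
  using assms
proof (induction "nat (- (\<Sum>S\<in>UNIV. d S * int (card S)))" arbitrary: d rule: less_induct)
  case less
  note upper = less.prems(1) and total = less.prems(2)
  show ?case
  proof (cases "\<exists>S. d S < 0")
    case False
    then have "d S = 0" for S
      using total sum_nonneg_eq_0_iff[of UNIV d] by (simp add: not_less)
    then show ?thesis
      by (intro exI[of _ "\<lambda>_ _. 0"]) simp
  next
    case True
    then obtain S where "d S < 0"
      by blast
    then obtain k where k: "k \<in> S" and stay: "\<And>\<A>. closed_under_supersets \<A> \<Longrightarrow>
        sum d \<A> = 0 \<Longrightarrow> S \<in> \<A> \<Longrightarrow> S - {k} \<in> \<A>"
      using edge_within_tight_classes[OF upper total] by blast
    define R where "R = S - {k}"
    have R: "k \<notin> R" "insert k R = S"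
      using k by (auto simp: R_def)
    define d' where "d' T = d T + of_bool (T = S) - of_bool (T = R)" for T
    have test: "(\<Sum>T\<in>UNIV. d' T * w T) = (\<Sum>T\<in>UNIV. d T * w T) + w S - w R" for w
      by (simp add: d'_def algebra_simps sum.distrib sum_subtractf)
    have sum_d': "sum d' \<A> = sum d \<A> + of_bool (S \<in> \<A>) - of_bool (R \<in> \<A>)" for \<A>
      by (simp add: d'_def sum.distrib sum_subtractf)
    have upper': "sum d' \<A> \<le> 0" if "closed_under_supersets \<A>" for \<A>
    proof (cases "S \<in> \<A> \<and> R \<notin> \<A>")
      case True
      then have "sum d \<A> < 0"
        using upper[OF that] stay[OF that] by (fastforce simp: R_def)
      then show ?thesis
        using True by (simp add: sum_d')
    next
      case False
      then show ?thesis
        using upper[OF that] by (auto simp: sum_d')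
    qed
    have total': "sum d' UNIV = 0"
      using total by (simp add: sum_d')
    have bounded: "(\<Sum>T\<in>UNIV. e T * int (card T)) \<le> 0"
      if "\<And>\<A>. closed_under_supersets \<A> \<Longrightarrow> sum e \<A> \<le> 0" for e :: "'n set \<Rightarrow> int"
    proof -
      have "(\<Sum>T\<in>UNIV. e T * int (card T)) = (\<Sum>T\<in>UNIV. \<Sum>j\<in>UNIV. e T * of_bool (j \<in> T))"
        by (simp flip: sum_distrib_left)
      also have "\<dots> = (\<Sum>j\<in>UNIV. \<Sum>T\<in>UNIV. e T * of_bool (j \<in> T))"
        by (rule sum.swap)
      also have "\<dots> = (\<Sum>j\<in>UNIV. sum e {T. j \<in> T})"
        by simp
      also have "\<dots> \<le> 0"
        by (intro sum_nonpos that) (auto simp: closed_under_supersets_def)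
      finally show ?thesis .
    qed
    have "card S = Suc (card R)"
      using R by (metis card_insert_disjoint finite)
    then have "nat (- (\<Sum>T\<in>UNIV. d' T * int (card T))) < nat (- (\<Sum>T\<in>UNIV. d T * int (card T)))"
      using test[of "\<lambda>T. int (card T)"] bounded[OF upper'] by simp
    from less.hyps[OF this upper' total'] obtain \<eta> :: "'n \<Rightarrow> 'n set \<Rightarrow> nat" where
      loopless: "\<And>i B. i \<in> B \<Longrightarrow> \<eta> i B = 0" and
      flow: "\<And>w. (\<Sum>T\<in>UNIV. d' T * w T)
        = (\<Sum>i\<in>UNIV. \<Sum>B\<in>UNIV. int (\<eta> i B) * (w B - w (insert i B)))"
      by blast
    define \<eta>' where "\<eta>' i B = \<eta> i B + of_bool (i = k \<and> B = R)" for i B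
    have "(\<Sum>i\<in>UNIV. \<Sum>B\<in>UNIV. int (\<eta>' i B) * (w B - w (insert i B)))
        = (\<Sum>T\<in>UNIV. d T * w T)" for w
    proof -
      have "(\<Sum>i\<in>UNIV. \<Sum>B\<in>UNIV. of_bool (i = k \<and> B = R) * (w B - w (insert i B)))
          = (\<Sum>i\<in>UNIV. if i = k then w R - w (insert i R) else 0)"
        by (intro sum.cong) auto
      also have "\<dots> = w R - w S"
        using R by simp
      finally show ?thesis
        using flow[of w] test[of w]
        by (simp add: \<eta>'_def distrib_right sum.distrib)
    qed
    moreover have "\<eta>' i B = 0" if "i \<in> B" for i B
      using loopless[OF that] R(1) that by (auto simp: \<eta>'_def)
    ultimately show ?thesis
      by (intro exI[of _ \<eta>']) simp
  qed
qed

section \<open>Testing standard imsets against weights\<close>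

lemma standard_imset_nth:
  "standard_imset G $ S = of_bool (S = UNIV) - of_bool (S = {})
     + (\<Sum>i\<in>UNIV. of_bool (S = parents G i) - of_bool (S = insert i (parents G i)))"
  by (simp add: standard_imset_def delta_def of_bool_def)

lemma standard_imset_weight:
  fixes w :: "'n::finite set \<Rightarrow> real"
  shows "(\<Sum>T\<in>UNIV. standard_imset G $ T * w T)
    = w UNIV - w {} + (\<Sum>i\<in>UNIV. w (parents G i) - w (insert i (parents G i)))"
proof -
  have "(\<Sum>T\<in>UNIV. (\<Sum>i\<in>UNIV. of_bool (T = parents G i) - of_bool (T = insert i (parents G i))) * w T)
     = (\<Sum>i\<in>UNIV. \<Sum>T\<in>UNIV. (of_bool (T = parents G i) - of_bool (T = insert i (parents G i))) * w T)"
    unfolding sum_distrib_right by (rule sum.swap)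
  then show ?thesis
    by (simp add: standard_imset_nth algebra_simps sum.distrib sum_subtractf)
qed

lemma sum_class_as_weight:
  fixes u :: "real ^ 'n::finite set"
  shows "sum (($) u) \<A> = (\<Sum>T\<in>UNIV. u $ T * of_bool (T \<in> \<A>))"
  by simp

text \<open>With truncated subtraction, a set that meets \<open>C\<close> in at most one element has weight zero.\<close>

lemma cluster_sum_as_weight:
  fixes u :: "real ^ 'n::finite set"
  shows "(\<Sum>T | card (C \<inter> T) \<ge> 2. u $ T * (real (card (C \<inter> T)) - 1))
    = (\<Sum>T\<in>UNIV. u $ T * real (card (C \<inter> T) - 1))"
  by (rule sum.mono_neutral_cong_left) auto

lemma standard_imset_cluster_sum:
  fixes G :: "('n::finite \<times> 'n) set"
  assumes "digraph G"
  shows "(\<Sum>T\<in>UNIV. standard_imset G $ T * real (card (C \<inter> T) - 1))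
    = real (card C - 1) - real (card {i\<in>C. C \<inter> parents G i \<noteq> {}})"
proof -
  have "real (card (C \<inter> parents G i) - 1) - real (card (C \<inter> insert i (parents G i)) - 1)
      = - of_bool (i \<in> C \<and> C \<inter> parents G i \<noteq> {})" for i
  proof -
    have "i \<notin> C \<inter> parents G i"
      using assms by (auto simp: digraph_def irrefl_def parents_def)
    then show ?thesis
      by (cases "C \<inter> parents G i = {}") (auto simp: Int_insert_right Suc_leI card_gt_0_iff)
  qed
  then show ?thesis
    by (simp add: standard_imset_weight sum_negf)
qed

text \<open>
  The cluster inequality for \<open>C\<close> says that at most \<open>|C| - 1\<close> nodes of \<open>C\<close> have a parent in \<open>C\<close>, that
  is, \<open>C\<close> has a minimal element for the arrow relation. Singletons have one by looplessness, so the
  inequalities for \<open>|C| \<ge> 2\<close> suffice for well-foundedness.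
\<close>

lemma acyclic_iff_cluster_inequalities:
  fixes G :: "('n::finite \<times> 'n) set"
  assumes G: "digraph G"
  shows "acyclic G \<longleftrightarrow>
    (\<forall>C. card C \<ge> 2 \<longrightarrow> (\<Sum>T\<in>UNIV. standard_imset G $ T * real (card (C \<inter> T) - 1)) \<ge> 0)"
proof -
  have minimal: "(\<Sum>T\<in>UNIV. standard_imset G $ T * real (card (C \<inter> T) - 1)) \<ge> 0
      \<longleftrightarrow> (\<exists>i\<in>C. C \<inter> parents G i = {})" (is "?L \<longleftrightarrow> ?R") if "card C \<ge> 2" for C
  proof -
    let ?D = "{i\<in>C. C \<inter> parents G i \<noteq> {}}"
    have "?L \<longleftrightarrow> card ?D < card C"
      unfolding standard_imset_cluster_sum[OF G] using that by linarith
    also have "\<dots> \<longleftrightarrow> ?D \<noteq> C"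
      using psubset_card_mono[of C ?D] by auto
    finally show ?thesis
      by blast
  qed
  have "acyclic G \<longleftrightarrow> wf G"
    using finite_acyclic_wf[of G] wf_acyclic by auto
  also have "\<dots> \<longleftrightarrow> (\<forall>C. C \<noteq> {} \<longrightarrow> (\<exists>i\<in>C. C \<inter> parents G i = {}))"
  proof -
    have "C \<inter> parents G i = {} \<longleftrightarrow> (\<forall>j. (j, i) \<in> G \<longrightarrow> j \<notin> C)" for C i
      by (auto simp: parents_def)
    then show ?thesis
      unfolding wf_eq_minimal by (simp add: ex_in_conv[symmetric])
  qed
  also have "\<dots> \<longleftrightarrow> (\<forall>C. card C \<ge> 2 \<longrightarrow> (\<exists>i\<in>C. C \<inter> parents G i = {}))"
  proof -
    have "\<exists>i\<in>C. C \<inter> parents G i = {}" if "C \<noteq> {}" "\<not> card C \<ge> 2" for C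
    proof -
      have "card C > 0"
        using that by (simp add: card_gt_0_iff)
      with that have "card C = 1"
        by linarith
      then show ?thesis
        using G by (auto simp: card_1_singleton_iff digraph_def irrefl_def parents_def)
    qed
    moreover have "C \<noteq> {}" if "card C \<ge> 2" for C :: "'n set"
      using that by auto
    ultimately show ?thesis
      by metis
  qed
  finally show ?thesis
    using minimal by simp
qed

section \<open>Integer points are imsets of digraphs\<close>

lemma integer_point_is_standard_imset:
  fixes u :: "real ^ 'n::finite set"
  assumes int: "u \<in> lattice_points"
    and total: "(\<Sum>T\<in>UNIV. u $ T) = 0"
    and single: "\<And>j. (\<Sum>T | j \<in> T. u $ T) = 0"
    and upper: "\<And>\<A>. \<A> \<noteq> {} \<Longrightarrow> {} \<notin> \<A> \<Longrightarrow> closed_under_supersets \<A> \<Longrightarrow> (\<Sum>T\<in>\<A>. u $ T) \<le> 1"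
  obtains G where "digraph G" "u = standard_imset G"
proof -
  from int have "\<forall>T. \<exists>z. u $ T = real_of_int z"
    by (auto simp: lattice_points_def elim: Ints_cases)
  then obtain v where v: "\<And>T. u $ T = real_of_int (v T)"
    by metis
  have sum_v: "real_of_int (sum v \<A>) = (\<Sum>T\<in>\<A>. u $ T)" for \<A>
    by (simp add: v)
  define d where "d T = v T - of_bool (T = UNIV) + of_bool (T = {})" for T
  have sum_d: "sum d \<A> = sum v \<A> - of_bool (UNIV \<in> \<A>) + of_bool ({} \<in> \<A>)" for \<A>
    by (simp add: d_def sum.distrib sum_subtractf)
  have total_v: "sum v UNIV = 0"
    using total sum_v[of UNIV] by linarith
  have total_d: "sum d UNIV = 0"
    by (simp add: sum_d total_v)
  have "sum d \<A> \<le> 0" if up: "closed_under_supersets \<A>" for \<A>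
  proof (cases "\<A> = {} \<or> {} \<in> \<A>")
    case True
    then have "\<A> = {} \<or> \<A> = UNIV"
      using up unfolding closed_under_supersets_def by blast
    then show ?thesis
      using total_d by auto
  next
    case False
    then have "UNIV \<in> \<A>"
      using up unfolding closed_under_supersets_def by blast
    moreover have "sum v \<A> \<le> 1"
      using upper[of \<A>] up False sum_v[of \<A>] by linarith
    ultimately show ?thesis
      using False by (simp add: sum_d)
  qed
  from integer_flow_on_Boolean_lattice[OF this total_d]
  obtain \<eta> :: "'n \<Rightarrow> 'n set \<Rightarrow> nat" where
    loopless: "\<And>i B. i \<in> B \<Longrightarrow> \<eta> i B = 0" and
    flow: "\<And>w. (\<Sum>S\<in>UNIV. d S * w S)
      = (\<Sum>i\<in>UNIV. \<Sum>B\<in>UNIV. int (\<eta> i B) * (w B - w (insert i B)))"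
    by blast
  \<comment> \<open>Testing the flow against the weight \<open>T \<mapsto> [j \<in> T]\<close> counts the units that remove \<open>j\<close>.\<close>
  have unit: "(\<Sum>B\<in>UNIV. \<eta> j B) = 1" for j
  proof -
    have "(\<Sum>B\<in>UNIV. int (\<eta> i B) * (of_bool (j \<in> B) - of_bool (j \<in> insert i B)))
        = (if i = j then - (\<Sum>B\<in>UNIV. int (\<eta> j B)) else 0)" for i
      unfolding sum_negf[symmetric] using loopless by (auto intro!: sum.cong sum.neutral)
    then have "- (\<Sum>B\<in>UNIV. int (\<eta> j B)) = (\<Sum>S\<in>UNIV. d S * of_bool (j \<in> S))"
      by (simp add: flow)
    also have "\<dots> = sum d {S. j \<in> S}"
      by simp
    also have "\<dots> = sum v {S. j \<in> S} - 1"
      by (simp add: sum_d)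
    also have "\<dots> = - 1"
      using single[of j] sum_v[of "{S. j \<in> S}"] by linarith
    finally show ?thesis
      by (simp flip: of_nat_sum)
  qed
  then have "\<exists>B. \<eta> j B = 1 \<and> (\<forall>C. C \<noteq> B \<longrightarrow> \<eta> j C = 0)" for j
    using sum_eq_1_iff[of UNIV "\<eta> j"] by auto
  then obtain B where B: "\<And>j. \<eta> j (B j) = 1" "\<And>j C. C \<noteq> B j \<Longrightarrow> \<eta> j C = 0"
    by metis
  define G where "G = {(j, i). j \<in> B i}"
  have parents: "parents G i = B i" for i
    by (simp add: parents_def G_def)
  have "i \<notin> B i" for i
    using loopless[of i "B i"] B(1)[of i] by auto
  then have "digraph G"
    by (auto simp: digraph_def irrefl_def G_def)
  moreover have "u $ S = standard_imset G $ S" for S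
  proof -
    have "\<eta> i C = of_bool (C = B i)" for i C
      using B by auto
    then have "d S = (\<Sum>i\<in>UNIV. of_bool (S = B i) - of_bool (S = insert i (B i)))"
      using flow[of "\<lambda>T. of_bool (S = T)"]
      by simp
    then have "real_of_int (v S - of_bool (S = UNIV) + of_bool (S = {}))
        = real_of_int (\<Sum>i\<in>UNIV. of_bool (S = B i) - of_bool (S = insert i (B i)))"
      by (simp add: d_def)
    then show ?thesis
      by (simp add: standard_imset_nth parents v)
  qed
  ultimately show ?thesis
    using that by (simp add: vec_eq_iff)
qed

section \<open>The relaxation\<close>

lemma polyhedron_weight_constraints:
  fixes w :: "'k::finite \<Rightarrow> real"
  shows "polyhedron {u. (\<Sum>T\<in>UNIV. u $ T * w T) \<le> b}"
    and "polyhedron {u. (\<Sum>T\<in>UNIV. u $ T * w T) \<ge> b}"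
    and "polyhedron {u. (\<Sum>T\<in>UNIV. u $ T * w T) = b}"
proof -
  have "(\<Sum>T\<in>UNIV. u $ T * w T) = (\<chi> T. w T) \<bullet> u" for u
    by (simp add: inner_vec_def mult.commute)
  then show "polyhedron {u. (\<Sum>T\<in>UNIV. u $ T * w T) \<le> b}"
    and "polyhedron {u. (\<Sum>T\<in>UNIV. u $ T * w T) \<ge> b}"
    and "polyhedron {u. (\<Sum>T\<in>UNIV. u $ T * w T) = b}"
    by (simp_all add: polyhedron_halfspace_le polyhedron_halfspace_ge polyhedron_hyperplane)
qed

lemma polyhedron_Collect_all:
  fixes P :: "'i::finite \<Rightarrow> 'a::euclidean_space \<Rightarrow> bool"
  assumes "\<And>i. Q i \<Longrightarrow> polyhedron {u. P i u}"
  shows "polyhedron {u. \<forall>i. Q i \<longrightarrow> P i u}"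
proof -
  have "{u. \<forall>i. Q i \<longrightarrow> P i u} = \<Inter> ((\<lambda>i. {u. P i u}) ` {i. Q i})"
    by auto
  then show ?thesis
    using assms by auto
qed

theorem corollary22:
  assumes "CARD('n::finite) \<ge> 2"
  shows "lp_relaxation
    {u :: real ^ 'n set.
       (\<Sum>T\<in>UNIV. u $ T) = 0
     \<and> (\<forall>j. (\<Sum>T | j \<in> T. u $ T) = 0)
     \<and> (\<forall>\<A> :: 'n set set. \<A> \<noteq> {} \<longrightarrow> {} \<notin> \<A> \<longrightarrow> closed_under_supersets \<A>
          \<longrightarrow> (\<Sum>T\<in>\<A>. u $ T) \<le> 1)
     \<and> (\<forall>C :: 'n set. card C \<ge> 2
          \<longrightarrow> (\<Sum>T | card (C \<inter> T) \<ge> 2. u $ T * (real (card (C \<inter> T)) - 1)) \<ge> 0)}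
    standard_imset_polytope"
    (is "lp_relaxation ?Q _")
proof -
  have polytope: "polytope (standard_imset_polytope :: (real ^ 'n set) set)"
    unfolding standard_imset_polytope_def by (intro polytope_convex_hull) simp
  have "?Q = {u. (\<Sum>T\<in>UNIV. u $ T * of_bool (T \<in> UNIV)) = 0}
      \<inter> ({u. \<forall>j. True \<longrightarrow> (\<Sum>T\<in>UNIV. u $ T * of_bool (T \<in> {T. j \<in> T})) = 0}
      \<inter> ({u. \<forall>\<A> :: 'n set set. \<A> \<noteq> {} \<and> {} \<notin> \<A> \<and> closed_under_supersets \<A>
            \<longrightarrow> (\<Sum>T\<in>UNIV. u $ T * of_bool (T \<in> \<A>)) \<le> 1}
      \<inter> {u. \<forall>C :: 'n set. card C \<ge> 2 \<longrightarrow> (\<Sum>T\<in>UNIV. u $ T * real (card (C \<inter> T) - 1)) \<ge> 0}))"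
    unfolding sum_class_as_weight[symmetric] cluster_sum_as_weight by auto
  also have "polyhedron \<dots>"
    by (intro polyhedron_Int polyhedron_Collect_all polyhedron_weight_constraints)
  finally have polyhedron: "polyhedron ?Q" .
  have "standard_imset G \<in> ?Q" if "acyclic_digraph G" for G :: "('n \<times> 'n) set"
  proof -
    have G: "digraph G" "acyclic G"
      using that by (simp_all add: acyclic_digraph_def)
    have "sum (($) (standard_imset G)) UNIV = 0"
      unfolding sum_class_as_weight standard_imset_weight by simp
    moreover have "sum (($) (standard_imset G)) {T. j \<in> T} = 0" for j
    proof -
      have "of_bool (j \<in> parents G i) - of_bool (j \<in> insert i (parents G i))
          = (if i = j then - 1 else (0::real))" for i
        using G(1) by (auto simp: digraph_def irrefl_def parents_def)
      then show ?thesis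
        unfolding sum_class_as_weight standard_imset_weight mem_Collect_eq by simp
    qed
    moreover have "sum (($) (standard_imset G)) \<A> \<le> 1"
      if "{} \<notin> \<A>" and up: "closed_under_supersets \<A>" for \<A>
    proof -
      have "(of_bool (parents G i \<in> \<A>) - of_bool (insert i (parents G i) \<in> \<A>) :: real) \<le> 0" for i
        using up subset_insertI[of "parents G i" i]
        unfolding closed_under_supersets_def by (auto simp: of_bool_def)
      then have "(\<Sum>i\<in>UNIV. of_bool (parents G i \<in> \<A>) - of_bool (insert i (parents G i) \<in> \<A>))
          \<le> (0::real)"
        by (intro sum_nonpos)
      then show ?thesis
        unfolding sum_class_as_weight standard_imset_weight using that
        by (simp add: of_bool_def split: if_splits)
    qed
    ultimately show ?thesis
      using acyclic_iff_cluster_inequalities[OF G(1)] G(2)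
      unfolding cluster_sum_as_weight by simp
  qed
  then have subset: "standard_imset_polytope \<subseteq> ?Q"
    unfolding standard_imset_polytope_def
    by (intro hull_minimal polyhedron_imp_convex[OF polyhedron]) blast
  have "u \<in> standard_imset_polytope" if u: "u \<in> ?Q" "u \<in> lattice_points" for u
  proof -
    have "\<exists>G. digraph G \<and> u = standard_imset G"
      by (rule integer_point_is_standard_imset[OF u(2)]) (use u(1) in blast)+
    then obtain G where G: "digraph G" "u = standard_imset G"
      by blast
    have "acyclic G"
      using u(1) unfolding acyclic_iff_cluster_inequalities[OF G(1)] cluster_sum_as_weight G(2)
      by blast
    then show ?thesis
      unfolding standard_imset_polytope_def
      using G by (intro hull_inc) (auto simp: acyclic_digraph_def)
  qed
  then have "?Q \<inter> lattice_points = standard_imset_polytope \<inter> lattice_points"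
    using subset by blast
  then show ?thesis
    unfolding lp_relaxation_def using polytope polyhedron subset by (intro conjI)
qed

end
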